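(* Let $Q\in\mathrm{Gr}(k,n)$ and $X\in\mathbb{T}_Q\mathrm{Gr}(k,n)$ with \[ Q=VI_{k,n-k}V^{\mathsf T},\qquad X=V\begin{bmatrix}0 & B \\ B^{\mathsf T} & 0\end{bmatrix}V^{\mathsf T}, \] where $V\in\mathrm{O}(n)$ and $B\in\mathbb{R}^{k\times(n-k)}$. Let $\gamma$ be the geodesic with $\gamma(0)=Q$, $\dot\gamma(0)=X$. Then the Riemannian exponential map is \[ \exp_Q(X):=\gamma(1)=V\exp\left(\frac12\begin{bmatrix}0 & -B \\ B^{\mathsf T} & 0\end{bmatrix}\right)I_{k,n-k}\exp\left(\frac12\begin{bmatrix}0 & B \\ -B^{\mathsf T} & 0\end{bmatrix}\right)V^{\mathsf T}, \] and the length of the geodesic segment from $\gamma(0)=Q$ to $\gamma(1)=\exp_Q(X)$ is $L(\gamma)=\|X\|_{\mathsf F}=\sqrt2\,\|B\|_{\mathsf F}$.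
   Context: For $k\in\{1,\dots,n\}$, $\mathrm{Gr}(k,n)=\{Q\in\mathrm{O}(n):Q^{\mathsf T}=Q,\ \operatorname{tr}(Q)=2k-n\}$, an embedded submanifold of $\mathbb{R}^{n\times n}$, equipped with the Riemannian metric $\langle X,Y\rangle_Q=\operatorname{tr}(XY)$ for $X,Y\in\mathbb{T}_Q\mathrm{Gr}(k,n)$. $I_{k,n-k}=\operatorname{diag}(I_k,-I_{n-k})$. Every $Q\in\mathrm{Gr}(k,n)$ can be written $Q=VI_{k,n-k}V^{\mathsf T}$ with $V\in\mathrm{O}(n)$, and $\mathbb{T}_Q\mathrm{Gr}(k,n)=\bigl\{V\begin{bmatrix}0 & B \\ B^{\mathsf T} & 0\end{bmatrix}V^{\mathsf T}:B\in\mathbb{R}^{k\times(n-k)}\bigr\}$. $\exp$ without subscript is the matrix exponential; $\|\cdot\|_{\mathsf F}$ is the Frobenius norm. *)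

theory Defs
  imports "HOL-Analysis.Analysis"
begin

section \<open>Embedded Riemannian submanifolds of a Euclidean space\<close>

text \<open>A \<open>C\<^sup>\<infinity>\<close> curve on an open set \<open>J\<close> of parameters; \<open>d m\<close> is the \<open>m\<close>-th derivative.\<close>

definition smooth_curve_on :: "real set \<Rightarrow> (real \<Rightarrow> 'a::euclidean_space) \<Rightarrow> bool" where
  "smooth_curve_on J c \<longleftrightarrow>
     (\<exists>d :: nat \<Rightarrow> real \<Rightarrow> 'a. d 0 = c \<and>
        (\<forall>m. \<forall>t\<in>J. (d m has_vector_derivative d (Suc m) t) (at t)))"

abbreviation velocity :: "(real \<Rightarrow> 'a::euclidean_space) \<Rightarrow> real \<Rightarrow> 'a" where
  "velocity c t \<equiv> vector_derivative c (at t)"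

definition tangent_space :: "'a::euclidean_space set \<Rightarrow> 'a \<Rightarrow> 'a set" where
  "tangent_space M p =
     {v. \<exists>c e. e > 0 \<and> smooth_curve_on {-e<..<e} c \<and> c ` {-e<..<e} \<subseteq> M \<and>
               c 0 = p \<and> velocity c 0 = v}"

definition orthogonal_projection :: "'a::euclidean_space set \<Rightarrow> 'a \<Rightarrow> 'a" where
  "orthogonal_projection T v = (THE u. u \<in> T \<and> (\<forall>w\<in>T. orthogonal (v - u) w))"

text \<open>The covariant derivative of a vector field \<open>Y\<close> along a curve \<open>c\<close> in \<open>M\<close>, for the
  Levi-Civita connection of the metric that \<open>M\<close> inherits from the ambient inner product: on such
  a Riemannian submanifold it is the tangential component of the ordinary derivative of \<open>Y\<close>.\<close>

definition covariant_derivative ::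
  "'a::euclidean_space set \<Rightarrow> (real \<Rightarrow> 'a) \<Rightarrow> (real \<Rightarrow> 'a) \<Rightarrow> real \<Rightarrow> 'a" where
  "covariant_derivative M c Y t =
     orthogonal_projection (tangent_space M (c t)) (vector_derivative Y (at t))"

definition geodesic_on :: "'a::euclidean_space set \<Rightarrow> real set \<Rightarrow> (real \<Rightarrow> 'a) \<Rightarrow> bool" where
  "geodesic_on M J c \<longleftrightarrow>
     open J \<and> is_interval J \<and> smooth_curve_on J c \<and> c ` J \<subseteq> M \<and>
     (\<forall>t\<in>J. covariant_derivative M c (velocity c) t = 0)"

definition geodesic_from ::
  "'a::euclidean_space set \<Rightarrow> 'a \<Rightarrow> 'a \<Rightarrow> real set \<Rightarrow> (real \<Rightarrow> 'a) \<Rightarrow> bool" where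
  "geodesic_from M p v J c \<longleftrightarrow>
     0 \<in> J \<and> geodesic_on M J c \<and> c 0 = p \<and> velocity c 0 = v"

text \<open>The geodesic with initial data \<open>(p, v)\<close> when it is defined for all times: every geodesic with
  the same initial data is a restriction of it.\<close>

definition is_the_geodesic ::
  "'a::euclidean_space set \<Rightarrow> 'a \<Rightarrow> 'a \<Rightarrow> (real \<Rightarrow> 'a) \<Rightarrow> bool" where
  "is_the_geodesic M p v \<gamma> \<longleftrightarrow>
     geodesic_from M p v UNIV \<gamma> \<and>
     (\<forall>J c. geodesic_from M p v J c \<longrightarrow> (\<forall>t\<in>J. c t = \<gamma> t))"

definition riemannian_exp :: "'a::euclidean_space set \<Rightarrow> 'a \<Rightarrow> 'a \<Rightarrow> 'a" where
  "riemannian_exp M p v = (THE q. \<exists>J c. 1 \<in> J \<and> geodesic_from M p v J c \<and> c 1 = q)"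

definition curve_length ::
  "('a::euclidean_space \<Rightarrow> 'a \<Rightarrow> 'a \<Rightarrow> real) \<Rightarrow> real \<Rightarrow> real \<Rightarrow> (real \<Rightarrow> 'a) \<Rightarrow> real" where
  "curve_length g a b c = integral {a..b} (\<lambda>t. sqrt (g (c t) (velocity c t) (velocity c t)))"


section \<open>Matrices\<close>

definition matrix_exp :: "real^'n^'n \<Rightarrow> real^'n^'n" where
  "matrix_exp A = (\<Sum>m. (1 / fact m) *\<^sub>R ((\<lambda>M. A ** M) ^^ m) (mat 1))"

lemma norm_eq_frobenius:
  fixes A :: "real^'n^'m"
  shows "norm A = sqrt (\<Sum>i\<in>UNIV. \<Sum>j\<in>UNIV. (A $ i $ j)\<^sup>2)"
  by (simp add: norm_vec_def L2_set_def sum_nonneg)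

text \<open>The order on the index type is used only to number the rows and columns as
  \<open>0, \<dots>, n - 1\<close>. Blocks are given by their entries, numbered from \<open>0\<close>, so that an empty
  block (\<open>k = n\<close>) is allowed; entries of a block outside its range are ignored.\<close>

definition pos :: "'n::{finite,linorder} \<Rightarrow> nat" where
  "pos i = card {j. j < i}"

type_synonym block = "nat \<Rightarrow> nat \<Rightarrow> real"

definition block_matrix ::
  "nat \<Rightarrow> block \<Rightarrow> block \<Rightarrow> block \<Rightarrow> block \<Rightarrow> real^'n::{finite,linorder}^'n::{finite,linorder}" where
  "block_matrix k A B C D =
     (\<chi> i j. if pos i < k
             then (if pos j < k then A (pos i) (pos j) else B (pos i) (pos j - k))
             else (if pos j < k then C (pos i - k) (pos j) else D (pos i - k) (pos j - k)))"

definition zero_block :: block where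
  "zero_block = (\<lambda>i j. 0)"

definition id_block :: block where
  "id_block = (\<lambda>i j. if i = j then 1 else 0)"

definition neg_block :: "block \<Rightarrow> block" where
  "neg_block B = (\<lambda>i j. - B i j)"

definition transpose_block :: "block \<Rightarrow> block" where
  "transpose_block B = (\<lambda>i j. B j i)"

definition frobenius_block :: "nat \<Rightarrow> nat \<Rightarrow> block \<Rightarrow> real" where
  "frobenius_block p q B = sqrt (\<Sum>i<p. \<Sum>j<q. (B i j)\<^sup>2)"

definition signature_matrix :: "nat \<Rightarrow> real^'n::{finite,linorder}^'n::{finite,linorder}" where
  "signature_matrix k = block_matrix k id_block zero_block zero_block (neg_block id_block)"


section \<open>The Grassmannian in the involution model\<close>

definition Gr :: "nat \<Rightarrow> (real^'n^'n) set" where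
  "Gr k = {Q. orthogonal_matrix Q \<and> transpose Q = Q \<and> trace Q = 2 * real k - real CARD('n)}"

definition Gr_metric :: "real^'n^'n \<Rightarrow> real^'n^'n \<Rightarrow> real^'n^'n \<Rightarrow> real" where
  "Gr_metric Q X Y = trace (X ** Y)"

lemma tangent_space_Gr_symmetric:
  assumes "X \<in> tangent_space (Gr k) Q"
  shows "transpose X = X"
proof -
  obtain c e where e: "e > 0" and c: "smooth_curve_on {-e<..<e} c" "c ` {-e<..<e} \<subseteq> Gr k"
    and X: "velocity c 0 = X"
    using assms unfolding tangent_space_def by blast
  have e0: "0 \<in> {-e<..<e}" using e by simp
  then have "\<exists>v. (c has_vector_derivative v) (at 0)"
    using c(1) unfolding smooth_curve_on_def by blast
  then have d: "(c has_vector_derivative X) (at 0)"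
    using X vector_derivative_works differentiableI_vector by blast
  have "bounded_linear (transpose :: real^'a^'a \<Rightarrow> real^'a^'a)"
    unfolding linear_conv_bounded_linear[symmetric]
    by (rule linearI) (simp_all add: transpose_def vec_eq_iff)
  then have "((\<lambda>t. transpose (c t)) has_vector_derivative transpose X) (at 0)"
    using d by (rule bounded_linear.has_vector_derivative)
  moreover have "transpose (c t) = c t" if "t \<in> {-e<..<e}" for t
    using c(2) that unfolding Gr_def by blast
  ultimately have "(c has_vector_derivative transpose X) (at 0)"
    using has_vector_derivative_transform_within_open[OF _ open_greaterThanLessThan e0] by blast
  then show ?thesis
    using d vector_derivative_unique_at by blast
qed

text \<open>The metric of the Grassmannian is the one induced by the ambient Euclidean space, so the
  notions above apply to it.\<close>

lemma Gr_metric_induced: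
  assumes "X \<in> tangent_space (Gr k) Q" "Y \<in> tangent_space (Gr k) Q"
  shows "Gr_metric Q X Y = X \<bullet> Y"
proof -
  have sym: "X $ i $ j = X $ j $ i" for i j
  proof -
    have "transpose X $ i $ j = X $ j $ i"
      by (simp add: transpose_def)
    then show ?thesis
      using tangent_space_Gr_symmetric[OF assms(1)] by simp
  qed
  have "Gr_metric Q X Y = (\<Sum>i\<in>UNIV. \<Sum>j\<in>UNIV. X $ i $ j * Y $ j $ i)"
    by (simp add: Gr_metric_def trace_def matrix_matrix_mult_def)
  also have "\<dots> = (\<Sum>i\<in>UNIV. \<Sum>j\<in>UNIV. X $ j $ i * Y $ j $ i)"
    by (intro sum.cong refl arg_cong2[where f = "(*)"] sym)
  also have "\<dots> = X \<bullet> Y"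
    by (subst sum.swap) (simp add: inner_vec_def)
  finally show ?thesis .
qed

end

theory Submission
  imports Defs
begin

text \<open>Differentiating \<open>Q\<^sup>2 = I\<close> shows that the tangent space at \<open>Q\<close> consists of the symmetric
  matrices that anticommute with \<open>Q\<close>; hence the symmetric matrices normal to it are those that
  commute with \<open>Q\<close>. For a geodesic \<open>c\<close>, differentiating \<open>c\<^sup>2 = I\<close> twice and using that \<open>c''\<close>
  commutes with \<open>c\<close> gives \<open>c'' c + c'\<^sup>2 = 0\<close>, that is \<open>(c' c)' = 0\<close>. So \<open>c' c = X Q\<close> is constant and
  \<open>c' = (X Q) c\<close> is a linear equation, whose solution is \<open>c t = exp (t X Q) Q\<close>. The
  formula in \<open>V\<close> and \<open>B\<close> follows by splitting the exponential into two halves and moving one of them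
  past \<open>Q\<close>, which changes the sign of its exponent.\<close>

section \<open>Matrix multiplication and transposition as bounded maps\<close>

lemma bounded_bilinear_matrix_mult:
  "bounded_bilinear ((**) :: real^'n^'m \<Rightarrow> real^'p^'n \<Rightarrow> real^'p^'m)"
  unfolding bilinear_conv_bounded_bilinear[symmetric] bilinear_def
  by (auto intro!: linearI simp: matrix_matrix_mult_def vec_eq_iff algebra_simps sum.distrib sum_distrib_left)

interpretation matrix_mult: bounded_bilinear "(**) :: real^'n^'m \<Rightarrow> real^'p^'n \<Rightarrow> real^'p^'m"
  by (rule bounded_bilinear_matrix_mult)

lemma bounded_linear_transpose: "bounded_linear (transpose :: real^'n^'m \<Rightarrow> real^'m^'n)"
  unfolding linear_conv_bounded_linear[symmetric]
  by (rule linearI) (simp_all add: transpose_def vec_eq_iff)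

lemma matrix_mult_uminus:
  fixes A :: "real^'n^'m" and B :: "real^'p^'n"
  shows "(- A) ** B = - (A ** B)" "A ** (- B) = - (A ** B)"
  by (rule matrix_mult.minus_left, rule matrix_mult.minus_right)

lemma transpose_simps:
  fixes A B :: "real^'n^'m"
  shows "transpose (- A) = - transpose A" "transpose (A - B) = transpose A - transpose B"
    "transpose (A + B) = transpose A + transpose B" "transpose (0 :: real^'n^'m) = 0"
  by (simp_all add: transpose_def vec_eq_iff)

section \<open>The matrix exponential\<close>

abbreviation matrix_power :: "real^'n^'n \<Rightarrow> nat \<Rightarrow> real^'n^'n" where
  "matrix_power A m \<equiv> ((\<lambda>M. A ** M) ^^ m) (mat 1)"

lemma matrix_power_scaleR: "matrix_power (t *\<^sub>R A) m = t ^ m *\<^sub>R matrix_power A m"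
  by (induction m) (simp_all add: matrix_mult.scaleR_left matrix_mult.scaleR_right)

lemma matrix_power_intertwine:
  assumes "A ** P = P ** B"
  shows "matrix_power A m ** P = P ** matrix_power B m"
proof (induction m)
  case (Suc m)
  have "A ** matrix_power A m ** P = A ** (P ** matrix_power B m)"
    by (simp add: Suc flip: matrix_mul_assoc)
  then show ?case
    by (simp add: matrix_mul_assoc assms)
qed simp

text \<open>Transposing moves the newest factor to the right end; it returns to the left because a
  matrix commutes with its own powers.\<close>

lemma transpose_matrix_power: "transpose (matrix_power A m) = matrix_power (transpose A) m"
  by (induction m) (simp_all add: matrix_transpose_mul matrix_power_intertwine)

text \<open>The scalar exponential series at \<open>norm A * K\<close> dominates, where
  \<open>K\<close> is a bound for the bilinear product.\<close>

lemma summable_matrix_exp: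
  fixes A :: "real^'n^'n"
  shows "summable (\<lambda>m. (1 / fact m) *\<^sub>R matrix_power A m)"
proof -
  obtain K where K: "K > 0" "\<And>(M :: real^'n^'n) (N :: real^'n^'n). norm (M ** N) \<le> norm M * norm N * K"
    using matrix_mult.pos_bounded by metis
  have bound: "norm (matrix_power A m) \<le> (norm A * K) ^ m * norm (mat 1 :: real^'n^'n)" for m
  proof (induction m)
    case (Suc m)
    have "norm (matrix_power A (Suc m)) \<le> norm A * K * norm (matrix_power A m)"
      using K(2)[of A "matrix_power A m"] by (simp add: mult.commute mult.left_commute)
    also have "\<dots> \<le> norm A * K * ((norm A * K) ^ m * norm (mat 1 :: real^'n^'n))"
      using Suc K(1) by (intro mult_left_mono) auto
    finally show ?case by (simp add: mult_ac)
  qed simp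
  have "summable (\<lambda>m. inverse (fact m) * (norm A * K) ^ m * norm (mat 1 :: real^'n^'n))"
    by (intro summable_mult2 summable_exp)
  then show ?thesis
  proof (rule summable_comparison_test')
    fix m
    show "norm ((1 / fact m) *\<^sub>R matrix_power A m)
        \<le> inverse (fact m) * (norm A * K) ^ m * norm (mat 1 :: real^'n^'n)"
      using mult_left_mono[OF bound[of m], of "inverse (fact m)"] by (simp add: inverse_eq_divide)
  qed
qed

lemma matrix_exp_sums: "(\<lambda>m. (1 / fact m) *\<^sub>R matrix_power A m) sums matrix_exp A"
  unfolding matrix_exp_def by (rule summable_sums[OF summable_matrix_exp])

text \<open>The relation passes to powers and then to the series. It serves three cases:
  \<open>B = A\<close> (commuting), \<open>B = - A\<close> (anticommuting) and \<open>P = V\<close>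
  (change of basis).\<close>

lemma matrix_exp_intertwine:
  assumes "A ** P = P ** B"
  shows "matrix_exp A ** P = P ** matrix_exp B"
proof -
  have "(\<lambda>m. (1 / fact m) *\<^sub>R matrix_power A m ** P) sums (matrix_exp A ** P)"
    by (rule bounded_linear.sums[OF matrix_mult.bounded_linear_left matrix_exp_sums])
  moreover have "(\<lambda>m. P ** ((1 / fact m) *\<^sub>R matrix_power B m)) sums (P ** matrix_exp B)"
    by (rule bounded_linear.sums[OF matrix_mult.bounded_linear_right matrix_exp_sums])
  ultimately show ?thesis
    by (simp add: matrix_mult.scaleR_left matrix_mult.scaleR_right
        matrix_power_intertwine[OF assms] sums_unique2)
qed

lemma transpose_matrix_exp: "transpose (matrix_exp A) = matrix_exp (transpose A)"
proof -
  have "(\<lambda>m. transpose ((1 / fact m) *\<^sub>R matrix_power A m)) sums transpose (matrix_exp A)"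
    by (rule bounded_linear.sums[OF bounded_linear_transpose matrix_exp_sums])
  then show ?thesis
    using matrix_exp_sums[of "transpose A"]
    by (simp add: transpose_scalar transpose_matrix_power sums_unique2)
qed

lemma matrix_exp_zero [simp]: "matrix_exp 0 = mat 1"
proof -
  have terms: "(1 / fact m) *\<^sub>R matrix_power (0 :: real^'n^'n) m = (if m = 0 then mat 1 else 0)" for m :: nat
    by (cases m) auto
  have "(\<lambda>m. if m = 0 then mat 1 else 0) sums matrix_exp (0 :: real^'n^'n)"
    using matrix_exp_sums[of "0 :: real^'n^'n"] unfolding terms .
  then show ?thesis
    using sums_single[of 0 "\<lambda>_. mat 1 :: real^'n^'n"] by (rule sums_unique2)
qed

text \<open>Pairing the exponential with a fixed matrix \<open>b\<close> gives a real power series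
  in \<open>t\<close>, which can be differentiated term by term; the coordinates are then
  reassembled.\<close>

lemma has_vector_derivative_matrix_exp:
  fixes A :: "real^'n^'n"
  shows "((\<lambda>t. matrix_exp (t *\<^sub>R A)) has_vector_derivative A ** matrix_exp (t *\<^sub>R A)) (at t)"
proof -
  define c where "c m = (1 / fact m) *\<^sub>R matrix_power A m" for m
  have sums: "(\<lambda>m. s ^ m *\<^sub>R c m) sums matrix_exp (s *\<^sub>R A)" for s
    using matrix_exp_sums[of "s *\<^sub>R A"] by (simp add: c_def matrix_power_scaleR mult.commute)
  have inner_sums: "(\<lambda>m. (c m \<bullet> b) * s ^ m) sums (matrix_exp (s *\<^sub>R A) \<bullet> b)" for s b
    using bounded_linear.sums[OF bounded_linear_inner_left[of b] sums[of s]]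
    unfolding inner_scaleR_left mult.commute[of "s ^ _"] .
  have fact_eq: "real (Suc m) * (1 / fact (Suc m)) = 1 / fact m" for m
    by (simp add: field_simps del: of_nat_Suc)
  \<comment> \<open>This recurrence turns the termwise derivative of the series into
    \<open>A\<close> times the series.\<close>
  have c_Suc: "real (Suc m) *\<^sub>R c (Suc m) = A ** c m" for m
    unfolding c_def scaleR_scaleR fact_eq by (simp add: matrix_mult.scaleR_right)
  have diffs_eq: "diffs (\<lambda>m. c m \<bullet> b) m * t ^ m = (A ** (t ^ m *\<^sub>R c m)) \<bullet> b" for m b
    by (simp only: diffs_def matrix_mult.scaleR_right inner_scaleR_left mult.commute flip: c_Suc)
  have deriv_sums: "(\<lambda>m. diffs (\<lambda>m. c m \<bullet> b) m * t ^ m) sums ((A ** matrix_exp (t *\<^sub>R A)) \<bullet> b)" for b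
    unfolding diffs_eq
    by (rule bounded_linear.sums[OF bounded_linear_inner_left
            bounded_linear.sums[OF matrix_mult.bounded_linear_right sums]])
  have deriv: "((\<lambda>t. matrix_exp (t *\<^sub>R A) \<bullet> b) has_real_derivative
      (A ** matrix_exp (t *\<^sub>R A)) \<bullet> b) (at t)" for b
  proof -
    have "((\<lambda>s. \<Sum>m. (c m \<bullet> b) * s ^ m) has_real_derivative
        (\<Sum>m. diffs (\<lambda>m. c m \<bullet> b) m * t ^ m)) (at t)"
      by (rule termdiffs_strong_converges_everywhere) (rule sums_summable[OF inner_sums])
    then show ?thesis
      unfolding sums_unique[OF inner_sums, symmetric] sums_unique[OF deriv_sums, symmetric] .
  qed
  have "((\<lambda>t. matrix_exp (t *\<^sub>R A) \<bullet> b) has_derivative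
      (\<lambda>x. (x *\<^sub>R (A ** matrix_exp (t *\<^sub>R A))) \<bullet> b)) (at t)" for b
    using deriv[of b] unfolding has_field_derivative_def inner_scaleR_left
    by (simp only: mult_commute_abs)
  then show ?thesis
    unfolding has_vector_derivative_def by (subst has_derivative_componentwise_within) blast
qed

section \<open>Linear matrix differential equations and the functional equation of the
  exponential\<close>

lemma linear_ode_unique:
  fixes c :: "real \<Rightarrow> real^'n^'n"
  assumes J: "open J" "is_interval J" "0 \<in> J"
    and c: "\<And>t. t \<in> J \<Longrightarrow> (c has_vector_derivative A ** c t) (at t)"
    and t: "t \<in> J"
  shows "matrix_exp (- t *\<^sub>R A) ** c t = c 0"
proof -
  \<comment> \<open>Integrating factor: the two terms of the derivative of \<open>F\<close> cancel
    because \<open>A\<close> commutes with the exponential of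
    \<open>s *\<^sub>R (- A)\<close>.\<close>
  define F where "F s = matrix_exp (s *\<^sub>R (- A)) ** c s" for s
  have "(F has_vector_derivative 0) (at s within J)" if s: "s \<in> J" for s
  proof -
    let ?E = "matrix_exp (s *\<^sub>R (- A))"
    have "?E ** A = A ** ?E"
      by (rule matrix_exp_intertwine) (simp add: matrix_mult.scaleR_left matrix_mult.scaleR_right matrix_mult_uminus)
    then have "?E ** (A ** c s) + ((- A) ** ?E) ** c s = 0"
      by (simp add: matrix_mult_uminus matrix_mul_assoc)
    moreover have "(F has_vector_derivative ?E ** (A ** c s) + ((- A) ** ?E) ** c s) (at s)"
      unfolding F_def by (rule matrix_mult.has_vector_derivative[OF has_vector_derivative_matrix_exp c[OF s]])
    ultimately show ?thesis
      using has_vector_derivative_at_within by metis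
  qed
  moreover have "convex J"
    using J(2) by (rule is_interval_convex)
  ultimately obtain K where "\<And>s. s \<in> J \<Longrightarrow> F s = K"
    using has_vector_derivative_zero_constant[of J F] by blast
  then have "F t = F 0"
    using t J(3) by simp
  then show ?thesis
    by (simp add: F_def)
qed

text \<open>The exponential curve of \<open>A\<close> itself solves the equation in
  \<open>linear_ode_unique\<close> and starts at \<open>mat 1\<close>; evaluate at time 1.\<close>

lemma matrix_exp_minus_left: "matrix_exp (- A) ** matrix_exp A = mat 1"
  using linear_ode_unique[of UNIV "\<lambda>t. matrix_exp (t *\<^sub>R A)" A 1, OF _ _ _ has_vector_derivative_matrix_exp]
  by simp

lemma linear_ode_solution:
  fixes c :: "real \<Rightarrow> real^'n^'n"
  assumes "open J" "is_interval J" "0 \<in> J"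
    and "\<And>t. t \<in> J \<Longrightarrow> (c has_vector_derivative A ** c t) (at t)"
    and "t \<in> J"
  shows "c t = matrix_exp (t *\<^sub>R A) ** c 0"
proof -
  have "matrix_exp (t *\<^sub>R A) ** (matrix_exp (- t *\<^sub>R A) ** c t) = c t"
    using matrix_exp_minus_left[of "- t *\<^sub>R A"] by (simp add: matrix_mul_assoc)
  then show ?thesis
    using linear_ode_unique[OF assms] by simp
qed

text \<open>The product of the two exponential curves solves \<open>c' = (A + B) c\<close> with
  initial value \<open>mat 1\<close>, so uniqueness identifies it at time 1.\<close>

lemma matrix_exp_add:
  assumes "A ** B = B ** A"
  shows "matrix_exp (A + B) = matrix_exp A ** matrix_exp B"
proof -
  define c where "c t = matrix_exp (t *\<^sub>R A) ** matrix_exp (t *\<^sub>R B)" for t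
  have "(c has_vector_derivative (A + B) ** c t) (at t)" for t
  proof -
    have "matrix_exp (t *\<^sub>R A) ** B = B ** matrix_exp (t *\<^sub>R A)"
      by (rule matrix_exp_intertwine) (simp add: matrix_mult.scaleR_left matrix_mult.scaleR_right assms)
    then have "matrix_exp (t *\<^sub>R A) ** (B ** matrix_exp (t *\<^sub>R B))
        + A ** matrix_exp (t *\<^sub>R A) ** matrix_exp (t *\<^sub>R B) = (A + B) ** c t"
      by (simp add: c_def matrix_mul_assoc matrix_mult.add_left)
    moreover have "(c has_vector_derivative matrix_exp (t *\<^sub>R A) ** (B ** matrix_exp (t *\<^sub>R B))
        + A ** matrix_exp (t *\<^sub>R A) ** matrix_exp (t *\<^sub>R B)) (at t)"
      unfolding c_def
      by (rule matrix_mult.has_vector_derivative[OF has_vector_derivative_matrix_exp has_vector_derivative_matrix_exp])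
    ultimately show ?thesis by simp
  qed
  then have "c 1 = matrix_exp (1 *\<^sub>R (A + B)) ** c 0"
    by (intro linear_ode_solution[of UNIV]) auto
  then show ?thesis
    by (simp add: c_def)
qed

lemma matrix_exp_halves:
  "matrix_exp A = matrix_exp ((1/2) *\<^sub>R A) ** matrix_exp ((1/2) *\<^sub>R A)"
  using matrix_exp_add[of "(1/2) *\<^sub>R A" "(1/2) *\<^sub>R A"] by (simp flip: scaleR_add_left)

lemma orthogonal_matrix_exp_skew:
  assumes "transpose A = - A"
  shows "orthogonal_matrix (matrix_exp A)"
  by (simp add: orthogonal_matrix transpose_matrix_exp assms matrix_exp_minus_left)

section \<open>The tangent spaces of the Grassmannian\<close>

lemma inner_matrix_eq_trace: "A \<bullet> B = trace (transpose A ** B)"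
  for A B :: "real^'n^'m"
  unfolding trace_def matrix_matrix_mult_def inner_vec_def transpose_def
  by (subst sum.swap) simp

lemma inner_orthogonal_matrix_left:
  fixes A B :: "real^'n^'n"
  assumes "orthogonal_matrix P"
  shows "(P ** A) \<bullet> (P ** B) = A \<bullet> B"
proof -
  have "transpose (P ** A) ** (P ** B) = transpose A ** (transpose P ** P) ** B"
    by (simp add: matrix_transpose_mul matrix_mul_assoc)
  then show ?thesis
    using assms by (simp add: inner_matrix_eq_trace orthogonal_matrix)
qed

lemma inner_transpose: "transpose A \<bullet> transpose B = A \<bullet> B"
  for A B :: "real^'n^'m"
  by (simp add: inner_matrix_eq_trace trace_mul_sym[of A])
    (simp flip: inner_matrix_eq_trace add: inner_commute)

lemma inner_orthogonal_matrix_right: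
  fixes A B :: "real^'n^'n"
  assumes "orthogonal_matrix P"
  shows "(A ** P) \<bullet> (B ** P) = A \<bullet> B"
  using inner_orthogonal_matrix_left[of "transpose P" "transpose A" "transpose B"] assms
  by (simp add: inner_transpose flip: matrix_transpose_mul)

lemma norm_orthogonal_conjugate:
  fixes A :: "real^'n^'n"
  assumes "orthogonal_matrix V"
  shows "norm (V ** A ** transpose V) = norm A"
  using assms by (simp add: norm_eq_sqrt_inner inner_orthogonal_matrix_left inner_orthogonal_matrix_right)

lemma Gr_square: "Q \<in> Gr k \<Longrightarrow> Q ** Q = mat 1"
  by (auto simp: Gr_def orthogonal_matrix_def)

lemma Gr_orthogonal_conjugate:
  assumes "Q \<in> Gr k" "orthogonal_matrix U"
  shows "U ** Q ** transpose U \<in> Gr k"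
proof -
  have "trace (U ** Q ** transpose U) = trace (transpose U ** U ** Q)"
    by (simp add: trace_mul_sym[of "U ** Q"] matrix_mul_assoc)
  then show ?thesis
    using assms
    by (simp add: Gr_def orthogonal_matrix_mul matrix_transpose_mul matrix_mul_assoc)
      (simp add: orthogonal_matrix)
qed

text \<open>Linearisation of \<open>Q ** Q = mat 1\<close> among symmetric matrices. For
  \<open>Q\<close> in \<open>Gr k\<close> its elements satisfy \<open>Q ** X ** Q = - X\<close> and
  so have trace 0, in agreement with the constant trace on \<open>Gr k\<close>.\<close>

definition Gr_tangent :: "real^'n^'n \<Rightarrow> (real^'n^'n) set" where
  "Gr_tangent Q = {X. transpose X = X \<and> X ** Q = - (Q ** X)}"

lemma subspace_Gr_tangent: "subspace (Gr_tangent Q)"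
  by (auto simp: Gr_tangent_def subspace_def transpose_scalar transpose_simps
      matrix_mult.add_left matrix_mult.add_right matrix_mult.scaleR_left matrix_mult.scaleR_right)

lemma transpose_derivative:
  fixes f :: "real \<Rightarrow> real^'n^'n"
  assumes "open J" "t \<in> J" "\<And>s. s \<in> J \<Longrightarrow> transpose (f s) = f s"
    and "(f has_vector_derivative v) (at t)"
  shows "transpose v = v"
proof -
  have "((\<lambda>s. transpose (f s)) has_vector_derivative transpose v) (at t)"
    by (rule bounded_linear.has_vector_derivative[OF bounded_linear_transpose assms(4)])
  then have "(f has_vector_derivative transpose v) (at t)"
    by (rule has_vector_derivative_transform_within_open[OF _ assms(1,2)]) (rule assms(3))
  then show ?thesis
    using assms(4) vector_derivative_unique_at by blast
qed

lemma Gr_velocity: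
  assumes "open J" "t \<in> J" "c ` J \<subseteq> Gr k" "(c has_vector_derivative v) (at t)"
  shows "c t ** v + v ** c t = 0"
proof -
  have "((\<lambda>s. c s ** c s) has_vector_derivative c t ** v + v ** c t) (at t)"
    by (rule matrix_mult.has_vector_derivative[OF assms(4,4)])
  then have "((\<lambda>s. mat 1) has_vector_derivative c t ** v + v ** c t) (at t)"
    by (rule has_vector_derivative_transform_within_open[OF _ assms(1,2)])
      (use assms(3) Gr_square in blast)
  then show ?thesis
    using vector_derivative_unique_at has_vector_derivative_const by blast
qed

section \<open>The candidate geodesics and the algebra of their generator
  \<open>X ** Q\<close>\<close>

definition Gr_geodesic :: "real^'n^'n \<Rightarrow> real^'n^'n \<Rightarrow> real \<Rightarrow> real^'n^'n" where
  "Gr_geodesic Q X t = matrix_exp (t *\<^sub>R (X ** Q)) ** Q"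

lemma Gr_geodesic_0 [simp]: "Gr_geodesic Q X 0 = Q"
  by (simp add: Gr_geodesic_def)

lemma Gr_geodesic_has_vector_derivative:
  "(Gr_geodesic Q X has_vector_derivative (X ** Q) ** Gr_geodesic Q X t) (at t)"
proof -
  have "((\<lambda>t. matrix_exp (t *\<^sub>R (X ** Q)) ** Q) has_vector_derivative
      (X ** Q) ** matrix_exp (t *\<^sub>R (X ** Q)) ** Q) (at t)"
    by (rule bounded_linear.has_vector_derivative[OF matrix_mult.bounded_linear_left
          has_vector_derivative_matrix_exp])
  then show ?thesis
    by (simp add: Gr_geodesic_def[abs_def] matrix_mul_assoc)
qed

lemma Gr_geodesic_velocity: "velocity (Gr_geodesic Q X) t = (X ** Q) ** Gr_geodesic Q X t"
  by (rule vector_derivative_at[OF Gr_geodesic_has_vector_derivative])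

text \<open>Each differentiation multiplies by the generator once more on the left; this family is
  the witness for smoothness.\<close>

lemma Gr_geodesic_derivatives:
  "((\<lambda>t. (((**) (X ** Q)) ^^ m) (Gr_geodesic Q X t)) has_vector_derivative
     (((**) (X ** Q)) ^^ Suc m) (Gr_geodesic Q X t)) (at t)"
proof (induction m)
  case 0
  show ?case using Gr_geodesic_has_vector_derivative by simp
next
  case (Suc m)
  show ?case
    using bounded_linear.has_vector_derivative[OF matrix_mult.bounded_linear_right Suc, of "X ** Q"]
    by simp
qed

lemma smooth_Gr_geodesic: "smooth_curve_on J (Gr_geodesic Q X)"
  unfolding smooth_curve_on_def
  using Gr_geodesic_derivatives
  by (intro exI[of _ "\<lambda>m t. (((**) (X ** Q)) ^^ m) (Gr_geodesic Q X t)"]) auto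

lemma Gr_generator_skew:
  assumes "Q \<in> Gr k" "X \<in> Gr_tangent Q"
  shows "transpose (X ** Q) = - (X ** Q)"
  using assms by (simp add: Gr_tangent_def Gr_def matrix_transpose_mul transpose_simps)

text \<open>Together the equations say that \<open>Q\<close> anticommutes with the generator; the
  first one also makes \<open>X\<close> the initial velocity.\<close>

lemma Gr_generator_anticommute:
  assumes "Q \<in> Gr k" "X \<in> Gr_tangent Q"
  shows "(X ** Q) ** Q = X" "Q ** (X ** Q) = - X"
proof -
  show "(X ** Q) ** Q = X"
    using Gr_square[OF assms(1)] by (simp flip: matrix_mul_assoc)
  have "Q ** (X ** Q) = - ((Q ** Q) ** X)"
    using assms(2) by (simp add: Gr_tangent_def matrix_mult_uminus flip: matrix_mul_assoc)
  then show "Q ** (X ** Q) = - X"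
    using Gr_square[OF assms(1)] by simp
qed

text \<open>The generator is skew, so this form is a conjugate of \<open>Q\<close> by an orthogonal
  matrix, which shows that the curve stays in \<open>Gr k\<close>.\<close>

lemma Gr_geodesic_conjugate:
  assumes "Q \<in> Gr k" "X \<in> Gr_tangent Q"
  shows "Gr_geodesic Q X t = matrix_exp ((t/2) *\<^sub>R (X ** Q)) ** Q ** matrix_exp (- ((t/2) *\<^sub>R (X ** Q)))"
proof -
  let ?E = "matrix_exp ((t/2) *\<^sub>R (X ** Q))"
  have "?E ** Q = Q ** matrix_exp (- ((t/2) *\<^sub>R (X ** Q)))"
    by (rule matrix_exp_intertwine)
      (simp add: matrix_mult_uminus matrix_mult.scaleR_left matrix_mult.scaleR_right
        Gr_generator_anticommute[OF assms])
  moreover have "matrix_exp (t *\<^sub>R (X ** Q)) = ?E ** ?E"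
    using matrix_exp_halves[of "t *\<^sub>R (X ** Q)"] by simp
  ultimately show ?thesis
    unfolding Gr_geodesic_def by (metis matrix_mul_assoc)
qed

lemma Gr_geodesic_in_Gr:
  assumes "Q \<in> Gr k" "X \<in> Gr_tangent Q"
  shows "Gr_geodesic Q X t \<in> Gr k"
proof -
  let ?A = "(t/2) *\<^sub>R (X ** Q)"
  have skew: "transpose ?A = - ?A"
    by (simp add: transpose_scalar Gr_generator_skew[OF assms])
  then have "Gr_geodesic Q X t = matrix_exp ?A ** Q ** transpose (matrix_exp ?A)"
    using Gr_geodesic_conjugate[OF assms] by (simp add: transpose_matrix_exp)
  then show ?thesis
    using Gr_orthogonal_conjugate[OF assms(1) orthogonal_matrix_exp_skew[OF skew]] by simp
qed

lemma tangent_space_Gr: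
  assumes "Q \<in> Gr k"
  shows "tangent_space (Gr k) Q = Gr_tangent Q"
proof (intro equalityI subsetI)
  fix X assume X: "X \<in> tangent_space (Gr k) Q"
  then obtain c e where e: "e > 0" and c: "smooth_curve_on {-e<..<e} c" "c ` {-e<..<e} \<subseteq> Gr k" "c 0 = Q"
    and v: "velocity c 0 = X"
    unfolding tangent_space_def by blast
  have e0: "0 \<in> {-e<..<e}" using e by simp
  then have "\<exists>v. (c has_vector_derivative v) (at 0)"
    using c(1) unfolding smooth_curve_on_def by blast
  then have "(c has_vector_derivative X) (at 0)"
    using v vector_derivative_works differentiableI_vector by blast
  then have "Q ** X + X ** Q = 0"
    using Gr_velocity[OF open_greaterThanLessThan e0 c(2)] c(3) by simp
  then show "X \<in> Gr_tangent Q"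
    using tangent_space_Gr_symmetric[OF X]
    by (simp add: Gr_tangent_def eq_neg_iff_add_eq_0 add.commute)
next
  fix X assume X: "X \<in> Gr_tangent Q"
  \<comment> \<open>The candidate geodesic, restricted to \<open>{-1<..<1}\<close>, realises
    \<open>X\<close> as a velocity.\<close>
  have "velocity (Gr_geodesic Q X) 0 = X"
    by (simp add: Gr_geodesic_velocity Gr_generator_anticommute[OF assms X])
  then show "X \<in> tangent_space (Gr k) Q"
    unfolding tangent_space_def
    using smooth_Gr_geodesic Gr_geodesic_in_Gr[OF assms X]
    by (intro CollectI exI[of _ "Gr_geodesic Q X"] exI[of _ 1]) auto
qed

section \<open>Geodesics\<close>

text \<open>The projection is a definite description, so it has to be shown well defined: the
  orthogonal decomposition gives existence, and the difference of two candidates is orthogonal to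
  itself.\<close>

lemma orthogonal_projection_eq_0_iff:
  assumes "subspace T"
  shows "orthogonal_projection T v = 0 \<longleftrightarrow> (\<forall>w\<in>T. orthogonal v w)"
proof
  have unique: "u = u'"
    if "u \<in> T" "\<forall>w\<in>T. orthogonal (v - u) w" "u' \<in> T" "\<forall>w\<in>T. orthogonal (v - u') w" for u u'
  proof -
    have "u - u' \<in> T" using that assms subspace_diff by blast
    then have "(v - u') \<bullet> (u - u') - (v - u) \<bullet> (u - u') = 0"
      using that by (simp add: orthogonal_def)
    then have "(u - u') \<bullet> (u - u') = 0"
      by (simp flip: inner_diff_left)
    then show ?thesis by simp
  qed
  show "orthogonal_projection T v = 0" if "\<forall>w\<in>T. orthogonal v w"
    unfolding orthogonal_projection_def
    using that unique subspace_0[OF assms] by (intro the_equality) auto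
  obtain y z where "y \<in> span T" "\<And>w. w \<in> span T \<Longrightarrow> orthogonal z w" "v = y + z"
    using orthogonal_subspace_decomp_exists by blast
  then have y: "y \<in> T \<and> (\<forall>w\<in>T. orthogonal (v - y) w)"
    using assms by (metis add_diff_cancel_left' span_eq_iff)
  have "orthogonal_projection T v = y"
    unfolding orthogonal_projection_def using y unique by (intro the_equality) blast+
  then show "\<forall>w\<in>T. orthogonal v w" if "orthogonal_projection T v = 0"
    using y that by simp
qed

text \<open>On symmetric matrices \<open>A\<close>, the map \<open>P ** A ** P\<close> is an
  isometric involution. Its -1 eigenspace is \<open>Gr_tangent P\<close> and its +1 eigenspace
  consists of the matrices commuting with \<open>P\<close>, so the two are orthogonal
  complements.\<close>

lemma normal_Gr_iff:
  assumes P: "P \<in> Gr k" and Z: "transpose Z = Z"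
  shows "(\<forall>W\<in>Gr_tangent P. orthogonal Z W) \<longleftrightarrow> Z ** P = P ** Z"
proof
  have PP: "P ** P = mat 1" by (rule Gr_square[OF P])
  have orth: "orthogonal_matrix P" and tP: "transpose P = P" using P by (auto simp: Gr_def)
  have inv: "(P ** A ** P) \<bullet> (P ** B ** P) = A \<bullet> B" for A B
    by (simp add: inner_orthogonal_matrix_left inner_orthogonal_matrix_right orth)
  have conj: "P ** (P ** A ** P) ** P = A" for A
  proof -
    have "P ** (P ** A ** P) ** P = (P ** P) ** A ** (P ** P)"
      by (simp add: matrix_mul_assoc)
    then show ?thesis by (simp add: PP)
  qed
  show "Z ** P = P ** Z" if normal: "\<forall>W\<in>Gr_tangent P. orthogonal Z W"
  proof -
    \<comment> \<open>Twice the tangential component of \<open>Z\<close>. Normality makes it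
      orthogonal to \<open>Z\<close>, and then to itself.\<close>
    let ?W = "Z - P ** Z ** P"
    have "transpose ?W = ?W"
      using Z tP by (simp add: transpose_simps matrix_transpose_mul matrix_mul_assoc)
    moreover have "(P ** Z ** P) ** P = P ** Z" "P ** (P ** Z ** P) = Z ** P"
    proof -
      have "(P ** Z ** P) ** P = P ** Z ** (P ** P)" "P ** (P ** Z ** P) = (P ** P) ** Z ** P"
        by (simp_all add: matrix_mul_assoc)
      then show "(P ** Z ** P) ** P = P ** Z" "P ** (P ** Z ** P) = Z ** P"
        by (simp_all add: PP)
    qed
    ultimately have "?W \<in> Gr_tangent P"
      by (simp add: Gr_tangent_def matrix_mult.diff_left matrix_mult.diff_right)
    then have "Z \<bullet> ?W = 0"
      using normal by (simp add: orthogonal_def)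
    moreover have "(P ** Z ** P) \<bullet> ?W = - (Z \<bullet> ?W)"
      by (simp add: inner_diff_right inv) (simp add: inner_commute)
    ultimately have "?W \<bullet> ?W = 0"
      by (simp add: inner_diff_left)
    then have "Z = P ** Z ** P" by simp
    then show ?thesis
      using \<open>(P ** Z ** P) ** P = P ** Z\<close> by simp
  qed
  show "\<forall>W\<in>Gr_tangent P. orthogonal Z W" if comm: "Z ** P = P ** Z"
  proof
    fix W assume "W \<in> Gr_tangent P"
    then have "P ** W ** P = - W"
      using Gr_generator_anticommute[OF P] by (simp add: matrix_mul_assoc)
    moreover have "P ** Z ** P = Z"
      using PP by (simp add: comm flip: matrix_mul_assoc) (simp add: comm matrix_mul_assoc)
    ultimately have "Z \<bullet> (- W) = Z \<bullet> W"
      using inv[of Z W] by simp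
    then show "orthogonal Z W"
      by (simp add: orthogonal_def)
  qed
qed

lemma covariant_derivative_Gr_eq_0_iff:
  assumes "c t \<in> Gr k" "(Y has_vector_derivative Z) (at t)" "transpose Z = Z"
  shows "covariant_derivative (Gr k) c Y t = 0 \<longleftrightarrow> Z ** c t = c t ** Z"
  unfolding covariant_derivative_def tangent_space_Gr[OF assms(1)] vector_derivative_at[OF assms(2)]
    orthogonal_projection_eq_0_iff[OF subspace_Gr_tangent] normal_Gr_iff[OF assms(1,3)] ..

text \<open>For \<open>W\<close> the generator and \<open>P\<close> a point of the curve,
  \<open>W ** (W ** P)\<close> is the acceleration. The first equation makes it normal, the second
  yields its symmetry.\<close>

lemma anticommuting_square:
  fixes W P :: "real^'n^'n"
  assumes "P ** W = - (W ** P)"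
  shows "P ** (W ** (W ** P)) = W ** (W ** P) ** P" "P ** (W ** W) = W ** (W ** P)"
proof -
  have swap: "P ** (W ** A) = - (W ** (P ** A))" for A :: "real^'n^'n"
    using assms by (simp add: matrix_mul_assoc matrix_mult_uminus)
  show "P ** (W ** (W ** P)) = W ** (W ** P) ** P" "P ** (W ** W) = W ** (W ** P)"
    by (simp_all add: swap assms matrix_mult_uminus flip: matrix_mul_assoc)
qed

text \<open>Carries the anticommutation with the generator from \<open>Q\<close> to the later points
  \<open>E ** Q\<close>, where \<open>E\<close> is the exponential factor.\<close>

lemma anticommute_mult:
  fixes E P W :: "real^'n^'n"
  assumes "E ** W = W ** E" "P ** W = - (W ** P)"
  shows "(E ** P) ** W = - (W ** (E ** P))"
proof -
  have "(E ** P) ** W = E ** (P ** W)"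
    by (simp add: matrix_mul_assoc)
  also have "\<dots> = - (W ** (E ** P))"
    unfolding assms(2) by (simp add: matrix_mult_uminus matrix_mul_assoc assms(1))
  finally show ?thesis .
qed

lemma geodesic_from_Gr_geodesic:
  assumes "Q \<in> Gr k" "X \<in> Gr_tangent Q"
  shows "geodesic_from (Gr k) Q X UNIV (Gr_geodesic Q X)"
proof -
  let ?\<gamma> = "Gr_geodesic Q X" and ?\<Omega> = "X ** Q"
  have "covariant_derivative (Gr k) ?\<gamma> (velocity ?\<gamma>) t = 0" for t
  proof -
    have deriv: "(velocity ?\<gamma> has_vector_derivative ?\<Omega> ** (?\<Omega> ** ?\<gamma> t)) (at t)"
      using Gr_geodesic_derivatives[of 1 X Q t] by (simp add: Gr_geodesic_velocity)
    have anti: "?\<gamma> t ** ?\<Omega> = - (?\<Omega> ** ?\<gamma> t)"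
      unfolding Gr_geodesic_def
    proof (rule anticommute_mult)
      show "matrix_exp (t *\<^sub>R ?\<Omega>) ** ?\<Omega> = ?\<Omega> ** matrix_exp (t *\<^sub>R ?\<Omega>)"
        by (rule matrix_exp_intertwine) (simp add: matrix_mult.scaleR_left matrix_mult.scaleR_right)
      show "Q ** ?\<Omega> = - (?\<Omega> ** Q)"
        using Gr_generator_anticommute[OF assms] by simp
    qed
    have "transpose (?\<gamma> t) = ?\<gamma> t"
      using Gr_geodesic_in_Gr[OF assms] by (auto simp: Gr_def)
    then have "transpose (?\<Omega> ** (?\<Omega> ** ?\<gamma> t)) = ?\<gamma> t ** ((- ?\<Omega>) ** (- ?\<Omega>))"
      by (simp only: matrix_transpose_mul[of ?\<Omega>] Gr_generator_skew[OF assms] flip: matrix_mul_assoc[of "?\<gamma> t"])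
    then have "transpose (?\<Omega> ** (?\<Omega> ** ?\<gamma> t)) = ?\<Omega> ** (?\<Omega> ** ?\<gamma> t)"
      by (simp only: anticommuting_square(2)[OF anti] matrix_mult_uminus minus_minus)
    then show ?thesis
      using covariant_derivative_Gr_eq_0_iff[OF Gr_geodesic_in_Gr[OF assms] deriv] anticommuting_square(1)[OF anti] by simp
  qed
  then show ?thesis
    unfolding geodesic_from_def geodesic_on_def
    using smooth_Gr_geodesic Gr_geodesic_in_Gr[OF assms]
    by (auto simp: Gr_geodesic_velocity Gr_generator_anticommute[OF assms])
qed

lemma geodesic_from_Gr_unique:
  assumes geo: "geodesic_from (Gr k) Q X J c" and t: "t \<in> J"
  shows "c t = Gr_geodesic Q X t"
proof -
  have J: "open J" "is_interval J" "0 \<in> J" and smooth: "smooth_curve_on J c" and cGr: "c ` J \<subseteq> Gr k"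
    and cov: "\<And>s. s \<in> J \<Longrightarrow> covariant_derivative (Gr k) c (velocity c) s = 0"
    and init: "c 0 = Q" "velocity c 0 = X"
    using geo by (simp_all add: geodesic_from_def geodesic_on_def)
  obtain d where "d 0 = c" and d: "\<And>m s. s \<in> J \<Longrightarrow> (d m has_vector_derivative d (Suc m) s) (at s)"
    using smooth unfolding smooth_curve_on_def by blast
  define c1 where "c1 = d 1"
  define c2 where "c2 = d 2"
  have c1: "(c has_vector_derivative c1 s) (at s)" and c2: "(c1 has_vector_derivative c2 s) (at s)"
    if "s \<in> J" for s
    using d[OF that, of 0] d[OF that, of 1] \<open>d 0 = c\<close> by (simp_all add: c1_def c2_def numeral_2_eq_2)
  have vel: "velocity c s = c1 s" if "s \<in> J" for s
    by (rule vector_derivative_at[OF c1[OF that]])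
  \<comment> \<open>The velocity is known to agree with \<open>c1\<close> only on \<open>J\<close>;
    openness of \<open>J\<close> lets the derivative carry over.\<close>
  have vel': "(velocity c has_vector_derivative c2 s) (at s)" if "s \<in> J" for s
    by (rule has_vector_derivative_transform_within_open[OF c2[OF that] J(1) that]) (simp add: vel)
  have sym: "transpose (c s) = c s" if "s \<in> J" for s
    using cGr that by (auto simp: Gr_def)
  have sym1: "transpose (c1 s) = c1 s" if "s \<in> J" for s
    by (rule transpose_derivative[OF J(1) that sym c1[OF that]])
  have sym2: "transpose (c2 s) = c2 s" if "s \<in> J" for s
    by (rule transpose_derivative[OF J(1) that sym1 c2[OF that]])
  have normal: "c2 s ** c s = c s ** c2 s" if "s \<in> J" for s
  proof -
    have "c s \<in> Gr k" using cGr that by blast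
    then show ?thesis
      using covariant_derivative_Gr_eq_0_iff[OF _ vel'[OF that] sym2[OF that]] cov[OF that] by simp
  qed
  \<comment> \<open>Differentiate \<open>c c' + c' c = 0\<close> once more; since \<open>c''\<close>
    commutes with \<open>c\<close>, the result is twice the claimed sum.\<close>
  have const: "c1 s ** c1 s + c2 s ** c s = 0" if s: "s \<in> J" for s
  proof -
    have "((\<lambda>s. c s ** c1 s + c1 s ** c s) has_vector_derivative
        (c s ** c2 s + c1 s ** c1 s) + (c1 s ** c1 s + c2 s ** c s)) (at s)"
      by (intro has_vector_derivative_add matrix_mult.has_vector_derivative c1 c2 s)
    then have "((\<lambda>s. 0) has_vector_derivative
        (c s ** c2 s + c1 s ** c1 s) + (c1 s ** c1 s + c2 s ** c s)) (at s)"
      by (rule has_vector_derivative_transform_within_open[OF _ J(1) s])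
        (simp only: Gr_velocity[OF J(1) _ cGr c1])
    then have "(c s ** c2 s + c1 s ** c1 s) + (c1 s ** c1 s + c2 s ** c s) = 0"
      using vector_derivative_unique_at has_vector_derivative_const by blast
    then have "2 *\<^sub>R (c1 s ** c1 s + c2 s ** c s) = 0"
      by (simp add: normal[OF s] scaleR_2 add_ac)
    then show ?thesis by simp
  qed
  \<comment> \<open>The derivative of \<open>c' c\<close> is the sum in \<open>const\<close>, so on
    the interval \<open>J\<close> this product keeps its value \<open>X ** Q\<close> at time
    0.\<close>
  have "((\<lambda>s. c1 s ** c s) has_vector_derivative 0) (at s within J)" if "s \<in> J" for s
    using matrix_mult.has_vector_derivative[OF c2[OF that] c1[OF that]]
    by (simp add: const[OF that] has_vector_derivative_at_within)
  then obtain K where K: "\<And>s. s \<in> J \<Longrightarrow> c1 s ** c s = K"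
    using has_vector_derivative_zero_constant[OF is_interval_convex[OF J(2)], of "\<lambda>s. c1 s ** c s"]
    by blast
  have K_eq: "K = X ** Q"
    using K[OF J(3)] vel[OF J(3)] init by simp
  \<comment> \<open>Multiplying \<open>c' c = X Q\<close> by \<open>c\<close> on the right recovers
    \<open>c'\<close>, since \<open>c\<close> squares to the identity.\<close>
  have "(c has_vector_derivative (X ** Q) ** c s) (at s)" if "s \<in> J" for s
  proof -
    have "c s ** c s = mat 1"
      using Gr_square cGr that by blast
    moreover have "(X ** Q) ** c s = c1 s ** (c s ** c s)"
      unfolding matrix_mul_assoc[of "c1 s"] K[OF that] K_eq ..
    ultimately have "(X ** Q) ** c s = c1 s"
      by simp
    then show ?thesis
      using c1[OF that] by (simp only:)
  qed
  then show ?thesis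
    using linear_ode_solution[OF J _ t, of c "X ** Q"] unfolding Gr_geodesic_def init(1) by blast
qed

section \<open>The exponential map and the length\<close>

lemma is_the_geodesic_Gr_geodesic:
  assumes "Q \<in> Gr k" "X \<in> Gr_tangent Q"
  shows "is_the_geodesic (Gr k) Q X (Gr_geodesic Q X)"
  unfolding is_the_geodesic_def
  using geodesic_from_Gr_geodesic[OF assms] geodesic_from_Gr_unique by blast

text \<open>The geodesic on \<open>UNIV\<close> supplies the endpoint; any other geodesic with the
  same data defined at time 1 agrees with it there.\<close>

lemma riemannian_exp_is_the_geodesic:
  assumes "is_the_geodesic M p v \<gamma>"
  shows "riemannian_exp M p v = \<gamma> 1"
  unfolding riemannian_exp_def
  using assms unfolding is_the_geodesic_def by (intro the_equality) blast+

text \<open>The velocity is an orthogonal matrix times \<open>X\<close>, so the speed is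
  constant.\<close>

lemma curve_length_Gr_geodesic:
  assumes "Q \<in> Gr k" "X \<in> Gr_tangent Q"
  shows "curve_length Gr_metric 0 1 (Gr_geodesic Q X) = norm X"
proof -
  have speed: "sqrt (Gr_metric (Gr_geodesic Q X t) (velocity (Gr_geodesic Q X) t) (velocity (Gr_geodesic Q X) t))
      = norm X" for t
  proof -
    let ?\<gamma> = "Gr_geodesic Q X" and ?\<Omega> = "X ** Q"
    have E: "orthogonal_matrix (matrix_exp (t *\<^sub>R ?\<Omega>))"
      by (rule orthogonal_matrix_exp_skew) (simp add: transpose_scalar Gr_generator_skew[OF assms])
    have comm: "matrix_exp (t *\<^sub>R ?\<Omega>) ** ?\<Omega> = ?\<Omega> ** matrix_exp (t *\<^sub>R ?\<Omega>)"
      by (rule matrix_exp_intertwine) (simp add: matrix_mult.scaleR_left matrix_mult.scaleR_right)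
    have "?\<Omega> ** ?\<gamma> t = matrix_exp (t *\<^sub>R ?\<Omega>) ** (?\<Omega> ** Q)"
      by (simp only: Gr_geodesic_def matrix_mul_assoc[of _ ?\<Omega> Q] matrix_mul_assoc[of ?\<Omega> _ Q] comm)
    then have "?\<Omega> ** ?\<gamma> t = matrix_exp (t *\<^sub>R ?\<Omega>) ** X"
      by (simp only: Gr_generator_anticommute(1)[OF assms])
    then have vel: "velocity ?\<gamma> t = matrix_exp (t *\<^sub>R ?\<Omega>) ** X"
      by (simp add: Gr_geodesic_velocity)
    \<comment> \<open>Tangency allows the trace form \<open>Gr_metric\<close> to be replaced by the
      ambient inner product.\<close>
    have "velocity ?\<gamma> t \<in> tangent_space (Gr k) (?\<gamma> t)"
    proof -
      have "transpose (velocity ?\<gamma> t) = velocity ?\<gamma> t"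
        unfolding Gr_geodesic_velocity
        by (rule transpose_derivative[OF open_UNIV UNIV_I _ Gr_geodesic_has_vector_derivative])
          (use Gr_geodesic_in_Gr[OF assms] in \<open>auto simp: Gr_def\<close>)
      moreover have "?\<gamma> t ** velocity ?\<gamma> t + velocity ?\<gamma> t ** ?\<gamma> t = 0"
        unfolding Gr_geodesic_velocity
        by (rule Gr_velocity[OF open_UNIV UNIV_I _ Gr_geodesic_has_vector_derivative])
          (use Gr_geodesic_in_Gr[OF assms] in auto)
      ultimately show ?thesis
        by (simp add: tangent_space_Gr[OF Gr_geodesic_in_Gr[OF assms]] Gr_tangent_def
            eq_neg_iff_add_eq_0 add.commute)
    qed
    then have "Gr_metric (?\<gamma> t) (velocity ?\<gamma> t) (velocity ?\<gamma> t) = velocity ?\<gamma> t \<bullet> velocity ?\<gamma> t"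
      by (intro Gr_metric_induced)
    then show ?thesis
      by (simp only: vel inner_orthogonal_matrix_left[OF E] norm_eq_sqrt_inner)
  qed
  show ?thesis
    unfolding curve_length_def speed by simp
qed

section \<open>Block matrices\<close>

lemma strict_mono_pos: "strict_mono pos"
  unfolding pos_def by (auto intro!: strict_monoI psubset_card_mono)

lemmas pos_eq_iff = strict_mono_eq[OF strict_mono_pos]

text \<open>Turns sums over the index type into sums over numbers, which can be split at
  \<open>k\<close>.\<close>

lemma bij_betw_pos: "bij_betw pos (UNIV :: 'n::{finite,linorder} set) {..<CARD('n)}"
proof -
  have inj: "inj (pos :: 'n \<Rightarrow> nat)"
    by (simp add: inj_def pos_eq_iff)
  have "range (pos :: 'n \<Rightarrow> nat) \<subseteq> {..<CARD('n)}"
    unfolding pos_def by (auto intro!: psubset_card_mono)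
  moreover have "card (range (pos :: 'n \<Rightarrow> nat)) = CARD('n)"
    by (rule card_image[OF inj])
  ultimately have "range (pos :: 'n \<Rightarrow> nat) = {..<CARD('n)}"
    by (intro card_subset_eq) auto
  then show ?thesis
    using inj by (simp add: bij_betw_def)
qed

lemma signature_matrix_nth:
  "signature_matrix k $ i $ j = (if i = j then if pos i < k then 1 else - 1 else 0)"
proof -
  \<comment> \<open>Truncated subtraction loses nothing here, as both positions are at least
    \<open>k\<close>.\<close>
  have "pos i - k = pos j - k \<longleftrightarrow> i = j" if "\<not> pos i < k" "\<not> pos j < k"
    using that pos_eq_iff[of i j] by linarith
  then show ?thesis
    by (auto simp: signature_matrix_def block_matrix_def id_block_def zero_block_def neg_block_def pos_eq_iff)
qed

lemma matrix_mult_signature: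
  "(A ** signature_matrix k) $ i $ j = A $ i $ j * (if pos j < k then 1 else - 1)"
  "(signature_matrix k ** A) $ i $ j = (if pos i < k then 1 else - 1) * A $ i $ j"
proof -
  have "A $ i $ l * signature_matrix k $ l $ j
      = (if l = j then A $ i $ j * (if pos j < k then 1 else - 1) else 0)" for l
    by (simp add: signature_matrix_nth)
  then show "(A ** signature_matrix k) $ i $ j = A $ i $ j * (if pos j < k then 1 else - 1)"
    by (simp add: matrix_matrix_mult_def)
  have "signature_matrix k $ i $ l * A $ l $ j
      = (if l = i then (if pos i < k then 1 else - 1) * A $ i $ j else 0)" for l
    by (simp add: signature_matrix_nth)
  then show "(signature_matrix k ** A) $ i $ j = (if pos i < k then 1 else - 1) * A $ i $ j"
    by (simp add: matrix_matrix_mult_def)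
qed

text \<open>\<open>W\<close> is the generator \<open>X ** Q\<close> in the basis given by
  \<open>V\<close>. The signature negates the last columns or rows, depending on the side, so it
  anticommutes with \<open>W\<close>; the second exponent of the final formula is a multiple of
  \<open>- W\<close>.\<close>

lemma block_matrix_signature:
  fixes k :: nat and B :: block
  defines "W \<equiv> block_matrix k zero_block (neg_block B) (transpose_block B) zero_block"
  shows "block_matrix k zero_block B (transpose_block B) zero_block ** signature_matrix k = W"
    and "W ** signature_matrix k = signature_matrix k ** (- W)"
    and "block_matrix k zero_block B (neg_block (transpose_block B)) zero_block = - W"
  by (simp_all add: vec_eq_iff matrix_mult_signature W_def)
    (simp_all add: block_matrix_def zero_block_def neg_block_def)

lemma norm_symmetric_block_matrix:
  fixes B :: block
  assumes "k \<le> CARD('n)"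
  shows "norm (block_matrix k zero_block B (transpose_block B) zero_block :: real^'n::{finite,linorder}^'n::{finite,linorder})
    = sqrt 2 * frobenius_block k (CARD('n) - k) B"
proof -
  let ?n = "CARD('n)"
  \<comment> \<open>The squared entries as a function of positions. Splitting both sums at
    \<open>k\<close> leaves the off-diagonal blocks, which contribute equally.\<close>
  define f :: block where "f a b = (if a < k then if b < k then 0 else (B a (b - k))\<^sup>2
      else if b < k then (B b (a - k))\<^sup>2 else 0)" for a b
  have split_add: "(\<Sum>a<k + m. g a) = (\<Sum>a<k. g a) + (\<Sum>a<m. g (a + k))" for m and g :: "nat \<Rightarrow> real"
    by (induction m) (simp_all add: add_ac)
  have split: "(\<Sum>a<?n. g a) = (\<Sum>a<k. g a) + (\<Sum>a<?n-k. g (a + k))" for g :: "nat \<Rightarrow> real"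
    using split_add[of g "?n - k"] assms by simp
  have "(\<Sum>i\<in>UNIV. \<Sum>j\<in>UNIV. (block_matrix k zero_block B (transpose_block B) zero_block $ (i::'n) $ (j::'n))\<^sup>2)
      = (\<Sum>i\<in>(UNIV::'n set). \<Sum>j\<in>(UNIV::'n set). f (pos i) (pos j))"
    by (intro sum.cong refl) (simp add: f_def block_matrix_def zero_block_def transpose_block_def)
  also have "\<dots> = (\<Sum>a<?n. \<Sum>b<?n. f a b)"
    unfolding sum.reindex_bij_betw[OF bij_betw_pos, of "f _"]
    by (rule sum.reindex_bij_betw[OF bij_betw_pos])
  also have "\<dots> = (\<Sum>a<k. \<Sum>b<?n-k. (B a b)\<^sup>2) + (\<Sum>a<?n-k. \<Sum>b<k. (B b a)\<^sup>2)"
    by (simp add: split f_def)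
  also have "\<dots> = 2 * (\<Sum>a<k. \<Sum>b<?n-k. (B a b)\<^sup>2)"
    using sum.swap[of "\<lambda>a b. (B b a)\<^sup>2" "{..<k}" "{..<?n-k}"] by simp
  finally show ?thesis
    by (simp add: norm_eq_frobenius frobenius_block_def real_sqrt_mult)
qed

theorem corollary4p4:
  fixes k :: nat and Q X V :: "real^'n::{finite,linorder}^'n::{finite,linorder}" and B :: block
  assumes "1 \<le> k" and "k \<le> CARD('n)"
    and "Q \<in> Gr k" and "X \<in> tangent_space (Gr k) Q"
    and "orthogonal_matrix V"
    and "Q = V ** signature_matrix k ** transpose V"
    and "X = V ** block_matrix k zero_block B (transpose_block B) zero_block ** transpose V"
  shows "\<exists>\<gamma>. is_the_geodesic (Gr k) Q X \<gamma>
      \<and> riemannian_exp (Gr k) Q X = \<gamma> 1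
      \<and> \<gamma> 1 =
            V ** matrix_exp ((1/2) *\<^sub>R block_matrix k zero_block (neg_block B) (transpose_block B) zero_block)
              ** signature_matrix k
              ** matrix_exp ((1/2) *\<^sub>R block_matrix k zero_block B (neg_block (transpose_block B)) zero_block)
              ** transpose V
      \<and> curve_length Gr_metric 0 1 \<gamma> = norm X
      \<and> norm X = sqrt 2 * frobenius_block k (CARD('n) - k) B"
proof -
  let ?S = "signature_matrix k :: real^'n::{finite,linorder}^'n::{finite,linorder}"
    and ?M = "block_matrix k zero_block B (transpose_block B) zero_block
      :: real^'n::{finite,linorder}^'n::{finite,linorder}"
    and ?W = "block_matrix k zero_block (neg_block B) (transpose_block B) zero_block
      :: real^'n::{finite,linorder}^'n::{finite,linorder}"
  have X: "X \<in> Gr_tangent Q"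
    using assms(3,4) tangent_space_Gr by blast
  have VV: "transpose V ** V = mat 1"
    using assms(5) by (simp add: orthogonal_matrix)
  have "X ** Q = V ** ?M ** (transpose V ** V) ** ?S ** transpose V"
    by (simp add: assms(6,7) matrix_mul_assoc)
  then have generator: "X ** Q = V ** ?W ** transpose V"
    by (simp add: VV block_matrix_signature(1) flip: matrix_mul_assoc)
  \<comment> \<open>Conjugation by \<open>V\<close> takes \<open>?W\<close> to
    \<open>X ** Q\<close>, so the exponential passes through \<open>V\<close>.\<close>
  have conj: "matrix_exp ((1/2) *\<^sub>R (X ** Q)) ** V = V ** matrix_exp ((1/2) *\<^sub>R ?W)"
  proof (rule matrix_exp_intertwine)
    show "(1/2) *\<^sub>R (X ** Q) ** V = V ** ((1/2) *\<^sub>R ?W)"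
      by (simp add: generator VV matrix_mult.scaleR_left matrix_mult.scaleR_right flip: matrix_mul_assoc)
  qed
  have anti: "matrix_exp ((1/2) *\<^sub>R ?W) ** ?S = ?S ** matrix_exp ((1/2) *\<^sub>R (- ?W))"
    by (rule matrix_exp_intertwine)
      (simp add: matrix_mult.scaleR_left matrix_mult.scaleR_right block_matrix_signature(2) matrix_mult_uminus)
  \<comment> \<open>Of the two half exponentials, the right one passes \<open>V\<close> and then the
    signature, where its exponent changes sign; the left one passes \<open>V\<close> only.\<close>
  have "Gr_geodesic Q X 1 = matrix_exp ((1/2) *\<^sub>R (X ** Q)) ** (matrix_exp ((1/2) *\<^sub>R (X ** Q)) ** V)
      ** ?S ** transpose V"
    using matrix_exp_halves[of "X ** Q"] by (simp add: Gr_geodesic_def assms(6) matrix_mul_assoc)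
  also have "\<dots> = matrix_exp ((1/2) *\<^sub>R (X ** Q)) ** V ** (matrix_exp ((1/2) *\<^sub>R ?W) ** ?S) ** transpose V"
    by (simp add: conj matrix_mul_assoc)
  also have "\<dots> = V ** matrix_exp ((1/2) *\<^sub>R ?W) ** ?S ** matrix_exp ((1/2) *\<^sub>R (- ?W)) ** transpose V"
    by (simp only: conj anti matrix_mul_assoc)
  finally have "Gr_geodesic Q X 1 =
      V ** matrix_exp ((1/2) *\<^sub>R ?W) ** ?S ** matrix_exp ((1/2) *\<^sub>R (- ?W)) ** transpose V" .
  moreover have "norm X = sqrt 2 * frobenius_block k (CARD('n) - k) B"
    using norm_orthogonal_conjugate[OF assms(5)] norm_symmetric_block_matrix[OF assms(2)]
    by (simp add: assms(7))
  ultimately show ?thesis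
    using is_the_geodesic_Gr_geodesic[OF assms(3) X] curve_length_Gr_geodesic[OF assms(3) X]
      riemannian_exp_is_the_geodesic[OF is_the_geodesic_Gr_geodesic[OF assms(3) X]]
    by (intro exI[of _ "Gr_geodesic Q X"]) (simp add: block_matrix_signature(3))
qed

end
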